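(* Let $A$ be a finite alphabet of size $N \ge 3$, let $\sigma : A \to A$ be a cyclic permutation of $A$ (i.e. $\sigma$ has a single cycle, of length $N$), and let $a_0 \in A$. Let $\delta = \sigma^j$ for some integer $j$ with $1 \le j < N$. If $j \not\equiv 1 \pmod N$, then the infinite word $W_{A,\sigma,a_0}$ is strongly $(3,\delta)$-free.
   Context: Words are finite or infinite sequences of symbols over a finite alphabet $A$; $A^*$ is the set of finite words. A factor of a word is a finite block of consecutive symbols occurring in it. Twisted form: for a permutation $\delta : A \to A$ and a word $w = a_1 a_2 \cdots a_n \in A^*$, the $\delta$-twisted form of $w$ is $w^{(\delta)} = \delta(a_1)\delta(a_2)\cdots\delta(a_n)$. Strongly $(k,\delta)$-repetition: a word $U \in A^*$ is a strongly $(k,\delta)$-repetition if $U = X_0 X_1 \cdots X_{k-1}$ where all $X_i$ have the same length $|X_i| = m \ge 1$ and $X_i = X_0^{(\delta^i)}$ for $i = 0, \dots, k-1$. Here $\delta^0$ is the identity and $\delta^i$ is the $i$-fold composition of $\delta$. Strongly $(k,\delta)$-free: a word $W$ is strongly $(k,\delta)$-free if no factor of $W$ is a strongly $(k,\delta)$-repetition. Cyclic shift morphism: for a permutation $\sigma$ of $A$, $\psi_{A,\sigma} : A^* \to A^*$ is the morphism (with respect to concatenation) defined by $\psi_{A,\sigma}(a) = a\,\sigma(a)$ for each $a \in A$. For $a_0 \in A$, $W_{A,\sigma,a_0} = \lim_{n\to\infty} \psi_{A,\sigma}^n(a_0)$ is the infinite word (indexed by the natural numbers) obtained by iterating $\psi_{A,\sigma}$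 on $a_0$, i.e. the unique one-sided infinite word having every $\psi_{A,\sigma}^n(a_0)$ as a prefix. *)

theory Defs
  imports
    "HOL-Library.Omega_Words_Fun"
    "HOL-Combinatorics.Permutations"
    "HOL-Combinatorics.Orbits"
    "HOL-Number_Theory.Cong"
begin

definition twisted :: "('a \<Rightarrow> 'a) \<Rightarrow> 'a list \<Rightarrow> 'a list" where
  "twisted \<delta> w = map \<delta> w"

definition strong_repetition :: "'a set \<Rightarrow> nat \<Rightarrow> ('a \<Rightarrow> 'a) \<Rightarrow> 'a list \<Rightarrow> bool" where
  "strong_repetition A k \<delta> U \<longleftrightarrow> U \<in> lists A \<and>
     (\<exists>X m. m \<ge> 1 \<and> U = concat (map X [0..<k]) \<and>
        (\<forall>i<k. length (X i) = m \<and> X i = twisted (\<delta> ^^ i) (X 0)))"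

definition factor :: "'a list \<Rightarrow> 'a word \<Rightarrow> bool" where
  "factor U W \<longleftrightarrow> (\<exists>i j. i \<le> j \<and> U = W [i \<rightarrow> j])"

definition strongly_free :: "'a set \<Rightarrow> nat \<Rightarrow> ('a \<Rightarrow> 'a) \<Rightarrow> 'a word \<Rightarrow> bool" where
  "strongly_free A k \<delta> W \<longleftrightarrow> \<not> (\<exists>U. factor U W \<and> strong_repetition A k \<delta> U)"

definition cyclic_shift_morphism :: "('a \<Rightarrow> 'a) \<Rightarrow> 'a list \<Rightarrow> 'a list" where
  "cyclic_shift_morphism \<sigma> w = concat (map (\<lambda>a. [a, \<sigma> a]) w)"

definition shift_word :: "('a \<Rightarrow> 'a) \<Rightarrow> 'a \<Rightarrow> 'a word" where
  "shift_word \<sigma> a\<^sub>0 = (THE W. \<forall>n. \<exists>l. (cyclic_shift_morphism \<sigma> ^^ n) [a\<^sub>0] = prefix l W)"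

lemma length_cyclic_shift_iter:
  "length ((cyclic_shift_morphism \<sigma> ^^ n) w) = 2 ^ n * length w"
proof -
  have "length (cyclic_shift_morphism \<sigma> v) = 2 * length v" for v
    by (induction v) (auto simp: cyclic_shift_morphism_def)
  then show ?thesis by (induction n) auto
qed

lemma cyclic_shift_iter_extend:
  "\<exists>v. (cyclic_shift_morphism \<sigma> ^^ (n + d)) [a] = (cyclic_shift_morphism \<sigma> ^^ n) [a] @ v"
proof -
  have app: "(cyclic_shift_morphism \<sigma> ^^ n) (u @ v) =
      (cyclic_shift_morphism \<sigma> ^^ n) u @ (cyclic_shift_morphism \<sigma> ^^ n) v" for n u v
    by (induction n) (auto simp: cyclic_shift_morphism_def)
  have "\<exists>v. (cyclic_shift_morphism \<sigma> ^^ d) [a] = [a] @ v"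
  proof (induction d)
    case (Suc d)
    then obtain v where "(cyclic_shift_morphism \<sigma> ^^ d) [a] = [a] @ v" by blast
    then have "(cyclic_shift_morphism \<sigma> ^^ Suc d) [a] =
        [a] @ (\<sigma> a # cyclic_shift_morphism \<sigma> v)"
      by (simp add: cyclic_shift_morphism_def[of _ "a # v"] cyclic_shift_morphism_def[of _ v])
    then show ?case by blast
  qed auto
  then show ?thesis by (metis app funpow_add o_apply)
qed

text \<open>The description in \<^const>\<open>shift_word\<close> always determines a word.\<close>

lemma shift_word_ex1:
  "\<exists>!W. \<forall>n. \<exists>l. (cyclic_shift_morphism \<sigma> ^^ n) [a] = prefix l W"
proof
  let ?p = "\<lambda>n. (cyclic_shift_morphism \<sigma> ^^ n) [a]"
  have len: "length (?p n) = 2 ^ n" for n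
    by (simp add: length_cyclic_shift_iter)
  have stable: "?p m ! i = ?p n ! i" if "n \<le> m" "i < 2 ^ n" for i m n
    using cyclic_shift_iter_extend[where \<sigma> = \<sigma> and n = n and d = "m - n" and a = a] that len[of n]
    by (auto simp: nth_append)
  have "?p n = prefix (2 ^ n) (\<lambda>i. ?p i ! i)" for n
  proof (rule nth_equalityI)
    fix i assume "i < length (?p n)"
    then have "i < 2 ^ n" "i < 2 ^ i" by (auto simp: len)
    then show "?p n ! i = prefix (2 ^ n) (\<lambda>i. ?p i ! i) ! i"
      using stable[of i n i] stable[of n i i]
      by (cases "i \<le> n") (auto simp: subsequence_def)
  qed (simp add: len)
  then show "\<forall>n. \<exists>l. ?p n = prefix l (\<lambda>i. ?p i ! i)" by blast
  fix W assume "\<forall>n. \<exists>l. ?p n = prefix l W"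
  then obtain l where l: "?p n = prefix (l n) W" for n by metis
  have "l n = 2 ^ n" for n using len[of n] l[of n] by (simp add: subsequence_def)
  then show "W = (\<lambda>i. ?p i ! i)" using l by (auto simp: subsequence_def)
qed

end

theory Submission
  imports Defs
begin

text \<open>
  The word \<open>W\<close> satisfies \<open>W (2 * n) = W n\<close> and \<open>W (2 * n + 1) = \<sigma> (W n)\<close>, and a strongly
  \<open>(3, \<delta>)\<close>-repetition of period \<open>m\<close> at position \<open>p\<close> means that \<open>W (q + m) = \<delta> (W q)\<close> on the
  window \<open>p \<le> q < p + 2 * m\<close>. If \<open>m\<close> is even, restricting to even \<open>q\<close> gives a repetition of
  period \<open>m div 2\<close>. If \<open>m = 1\<close>, an even \<open>q\<close> in the window gives \<open>\<delta> (W q) = \<sigma> (W q)\<close>, whence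
  \<open>j = 1\<close>. If \<open>m = 2 * k + 1 \<ge> 3\<close>, comparing \<open>q = 2 * r\<close> with \<open>q = 2 * r + 1\<close> gives
  \<open>W (r + k + 1) = \<sigma> (\<sigma> (W (r + k)))\<close> for two consecutive \<open>r\<close>; for the one with \<open>r + k\<close> even
  the left-hand side is \<open>\<sigma> (W (r + k))\<close>, so \<open>\<sigma>\<close> has a fixed point, which is absurd.
\<close>

lemma cyclic_shift_morphism_Cons:
  "cyclic_shift_morphism \<sigma> (a # w) = a # \<sigma> a # cyclic_shift_morphism \<sigma> w"
  by (simp add: cyclic_shift_morphism_def)

lemma nth_cyclic_shift_morphism:
  assumes "i < length w"
  shows "cyclic_shift_morphism \<sigma> w ! (2 * i) = w ! i"
    and "cyclic_shift_morphism \<sigma> w ! Suc (2 * i) = \<sigma> (w ! i)"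
  using assms
proof (induction w arbitrary: i)
  case (Cons a w)
  { case 1 then show ?case
      using Cons.IH(1) by (cases i) (auto simp: cyclic_shift_morphism_Cons) }
  { case 2 then show ?case
      using Cons.IH(2) by (cases i) (auto simp: cyclic_shift_morphism_Cons) }
qed auto

lemma prefix_shift_word:
  "prefix (2 ^ n) (shift_word \<sigma> a) = (cyclic_shift_morphism \<sigma> ^^ n) [a]"
proof -
  have "\<forall>n. \<exists>l. (cyclic_shift_morphism \<sigma> ^^ n) [a] = prefix l (shift_word \<sigma> a)"
    unfolding shift_word_def by (rule theI'[OF shift_word_ex1])
  then obtain l where l: "(cyclic_shift_morphism \<sigma> ^^ n) [a] = prefix l (shift_word \<sigma> a)"
    by blast
  then have "l = 2 ^ n"
    using length_cyclic_shift_iter[of n \<sigma> "[a]"] by (simp add: subsequence_def)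
  with l show ?thesis by simp
qed

lemma shift_word_nth:
  "i < 2 ^ n \<Longrightarrow> shift_word \<sigma> a i = (cyclic_shift_morphism \<sigma> ^^ n) [a] ! i"
  by (simp flip: prefix_shift_word add: subsequence_def)

lemma shift_word_0: "shift_word \<sigma> a 0 = a"
  using shift_word_nth[of 0 0] by simp

text \<open>Iterate \<open>Suc n\<close> is the morphism applied to iterate \<open>n\<close>, whose
  length \<open>2 ^ n\<close> already exceeds \<open>n\<close>.\<close>

lemma shift_word_double:
  shows "shift_word \<sigma> a (2 * n) = shift_word \<sigma> a n"
    and "shift_word \<sigma> a (Suc (2 * n)) = \<sigma> (shift_word \<sigma> a n)"
proof -
  have n: "n < 2 ^ n" by simp
  then have "2 * n < 2 ^ Suc n" "Suc (2 * n) < 2 ^ Suc n" by (auto, linarith)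
  with n show "shift_word \<sigma> a (2 * n) = shift_word \<sigma> a n"
    and "shift_word \<sigma> a (Suc (2 * n)) = \<sigma> (shift_word \<sigma> a n)"
    by (simp_all only: shift_word_nth funpow.simps o_apply)
      (simp_all add: nth_cyclic_shift_morphism length_cyclic_shift_iter)
qed

lemma shift_word_in:
  assumes "\<sigma> permutes A" and "a \<in> A"
  shows "shift_word \<sigma> a n \<in> A"
proof (induction n rule: less_induct)
  case (less n)
  have "n = 0 \<or> n = 2 * (n div 2) \<and> n div 2 < n \<or> n = Suc (2 * (n div 2)) \<and> n div 2 < n"
    by presburger
  then consider "n = 0" | k where "n = 2 * k" "k < n" | k where "n = Suc (2 * k)" "k < n"
    by blast
  then show ?case
    by cases (use assms less in \<open>auto simp: shift_word_0 shift_word_double permutes_in_image\<close>)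
qed

lemma no_twisted_cube:
  fixes W :: "'a word" and p m :: nat
  assumes W: "\<And>n. W (2 * n) = W n" "\<And>n. W (Suc (2 * n)) = \<sigma> (W n)"
    and comm: "\<delta> \<circ> \<sigma> = \<sigma> \<circ> \<delta>"
    and fixed: "\<And>n. \<sigma> (W n) \<noteq> W n" "\<And>n. \<delta> (W n) \<noteq> \<sigma> (W n)"
    and "inj \<sigma>" and "m > 0"
  shows "\<exists>q. p \<le> q \<and> q < p + 2 * m \<and> W (q + m) \<noteq> \<delta> (W q)"
  using \<open>m > 0\<close>
\<comment> \<open>The start \<open>p\<close> is generalized because the descent halves it together
  with \<open>m\<close>.\<close>
proof (induction m arbitrary: p rule: less_induct)
  case (less m)
  show ?case
  proof (rule ccontr)
    assume "\<not> ?thesis"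
    then have rep: "W (q + m) = \<delta> (W q)" if "p \<le> q" "q < p + 2 * m" for q
      using that by blast
    have W_Suc: "W (Suc q) = \<sigma> (W q)" if "even q" for q
      using that W[of "q div 2"] by simp
    have "m = 1 \<or> m = 2 * (m div 2) \<and> 0 < m div 2 \<or> m = Suc (2 * (m div 2)) \<and> 0 < m div 2"
      using \<open>m > 0\<close> by presburger
    then consider "m = 1" | k where "m = 2 * k" "0 < k" | k where "m = Suc (2 * k)" "0 < k"
      by blast
    then show False
    proof cases
      case 1
      have "even p \<or> even (Suc p)" by simp
      then obtain q where "even q" "q = p \<or> q = Suc p" by blast
      then show False using rep[of q] W_Suc[of q] fixed(2)[of q] 1 by auto
    next
      case 2
      \<comment> \<open>Rounding \<open>p / 2\<close> up keeps \<open>2 * r\<close> at or after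
        \<open>p\<close>; the last such position is at most \<open>p + 2 * m - 1\<close>, still
        inside the window.\<close>
      obtain r where r: "(p + 1) div 2 \<le> r" "r < (p + 1) div 2 + 2 * k" "W (r + k) \<noteq> \<delta> (W r)"
        using less.IH[of k "(p + 1) div 2"] 2 by (metis less_add_same_cancel1 mult_2)
      then have "p \<le> 2 * r" "2 * r < p + 2 * m" using 2 by auto
      from rep[OF this] W(1)[of "r + k"] W(1)[of r] r(3) show False
        using 2 by (simp add: algebra_simps)
    next
      case 3
      \<comment> \<open>Since \<open>m\<close> is at least 3, the pairs \<open>2 * r\<close>,
        \<open>2 * r + 1\<close> for \<open>r = s\<close> and \<open>r = Suc s\<close> both fit in
        the window, so the parity of \<open>r + k\<close> can be chosen.\<close>
      define s where "s = (p + 1) div 2"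
      define r where "r = (if even (s + k) then s else Suc s)"
      have r: "even (r + k)" "r = s \<or> r = Suc s" by (simp_all add: r_def)
      then have window: "p \<le> 2 * r" "Suc (2 * r) < p + 2 * m"
        using 3 by (auto simp: s_def)
      \<comment> \<open>As \<open>m\<close> is odd, adding it swaps parities:
        \<open>2 * r + m = Suc (2 * (r + k))\<close> and
        \<open>Suc (2 * r) + m = 2 * Suc (r + k)\<close>.\<close>
      have "\<sigma> (W (r + k)) = \<delta> (W r)"
        using rep[of "2 * r"] window W(2)[of "r + k"] W(1)[of r] 3 by (simp add: algebra_simps)
      moreover have "W (Suc (r + k)) = \<delta> (\<sigma> (W r))"
        using rep[of "Suc (2 * r)"] window W(1)[of "Suc (r + k)"] W(2)[of r] 3
        by (simp add: algebra_simps)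
      ultimately have "\<sigma> (\<sigma> (W (r + k))) = \<sigma> (W (r + k))"
        using W_Suc[OF r(1)] fun_cong[OF comm, of "W r"] by simp
      then show False using injD[OF \<open>inj \<sigma>\<close>] fixed(1) by blast
    qed
  qed
qed

text \<open>If \<open>n\<close> were a period of \<open>x\<close>, exponents could be reduced mod
  \<open>n\<close>, and the orbit of \<open>x\<close>, which is all of \<open>A\<close>, would have
  at most \<open>n\<close> elements.\<close>

lemma funpow_cyclic_on_neq:
  assumes "cyclic_on f A" and "x \<in> A" and "0 < n" and "n < card A"
  shows "(f ^^ n) x \<noteq> x"
proof
  assume period: "(f ^^ n) x = x"
  have "A = orbit f x"
    using assms by (metis orbit_cyclic_eq3)
  also have "\<dots> \<subseteq> (\<lambda>i. (f ^^ i) x) ` {..<n}"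
  proof
    fix y assume "y \<in> orbit f x"
    then obtain i where "y = (f ^^ i) x" by (auto simp: orbit_altdef)
    then have "y = (f ^^ (i mod n)) x" using funpow_mod_eq[OF period] by simp
    then show "y \<in> (\<lambda>i. (f ^^ i) x) ` {..<n}" using \<open>0 < n\<close> by auto
  qed
  finally have "card A \<le> n"
    using surj_card_le[of "{..<n}"] by simp
  with \<open>n < card A\<close> show False by simp
qed

lemma strong_repetition_3E:
  assumes "factor U W" and "strong_repetition A 3 \<delta> U"
  obtains p m where "m > 0" and "\<And>q. p \<le> q \<Longrightarrow> q < p + 2 * m \<Longrightarrow> W (q + m) = \<delta> (W q)"
proof -
  obtain p e where U: "p \<le> e" "U = W [p \<rightarrow> e]"
    using assms(1) by (auto simp: factor_def)
  obtain X m where X: "m \<ge> 1" "U = concat (map X [0..<3])"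
      "\<And>i. i < 3 \<Longrightarrow> length (X i) = m \<and> X i = twisted (\<delta> ^^ i) (X 0)"
    using assms(2) by (auto simp: strong_repetition_def)
  define Y where "Y = X 0"
  have Y: "length Y = m" "U = Y @ map \<delta> Y @ map (\<delta> \<circ> \<delta>) Y"
    using X(2) X(3)[of 0] X(3)[of 1] X(3)[of 2]
    by (auto simp: Y_def twisted_def numeral_3_eq_3 numeral_2_eq_2)
  have nth: "W (p + i) = U ! i" if "i < 3 * m" for i
  proof -
    have "length U = 3 * m" using Y by simp
    then show ?thesis using U that by (simp add: subsequence_def)
  qed
  \<comment> \<open>The cases compare the first block with the second, and the second with the
    third.\<close>
  have "W (p + i + m) = \<delta> (W (p + i))" if "i < 2 * m" for i
    using nth[of i] nth[of "i + m"] that Y(1)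
    by (cases "i < m") (auto simp: Y(2) nth_append add.assoc)
  then have "W (q + m) = \<delta> (W q)" if "p \<le> q" "q < p + 2 * m" for q
    using that by (metis add_less_cancel_left le_add_diff_inverse)
  with X(1) show thesis using that[of m p] by simp
qed

theorem theorem2p6:
  fixes A :: "'a set" and \<sigma> \<delta> :: "'a \<Rightarrow> 'a" and a\<^sub>0 :: 'a and N j :: nat
  assumes "finite A" and "card A = N" and "N \<ge> 3"
    and "\<sigma> permutes A" and "cyclic_on \<sigma> A"
    and "a\<^sub>0 \<in> A"
    and "1 \<le> j" and "j < N" and "\<delta> = \<sigma> ^^ j"
    and "\<not> [j = 1] (mod N)"
  shows "strongly_free A 3 \<delta> (shift_word \<sigma> a\<^sub>0)"
  unfolding strongly_free_def
proof (intro notI, elim exE conjE)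
  let ?W = "shift_word \<sigma> a\<^sub>0"
  fix U assume "factor U ?W" "strong_repetition A 3 \<delta> U"
  then obtain p m where m: "m > 0"
    and rep: "\<And>q. p \<le> q \<Longrightarrow> q < p + 2 * m \<Longrightarrow> ?W (q + m) = \<delta> (?W q)"
    by (rule strong_repetition_3E) blast
  have inA: "?W n \<in> A" "\<sigma> (?W n) \<in> A" for n
    using shift_word_in[OF \<open>\<sigma> permutes A\<close> \<open>a\<^sub>0 \<in> A\<close>] permutes_in_image[OF \<open>\<sigma> permutes A\<close>] by auto
  have comm: "\<delta> \<circ> \<sigma> = \<sigma> \<circ> \<delta>"
    by (simp add: \<open>\<delta> = \<sigma> ^^ j\<close> flip: funpow_Suc_right)
  have no_fix: "\<sigma> (?W n) \<noteq> ?W n" for n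
    using funpow_cyclic_on_neq[OF \<open>cyclic_on \<sigma> A\<close> inA(1), of 1] assms by simp
  have "j \<noteq> 1" using \<open>\<not> [j = 1] (mod N)\<close> by auto
  \<comment> \<open>One \<open>\<sigma>\<close> is split off \<open>\<delta>\<close>: agreement of
    \<open>\<delta>\<close> and \<open>\<sigma>\<close> at \<open>?W n\<close> would make
    \<open>i\<close> a period of \<open>\<sigma> (?W n)\<close>.\<close>
  then obtain i where i: "j = Suc i" "0 < i" "i < card A"
    using assms by (cases j) auto
  have "\<delta> (?W n) \<noteq> \<sigma> (?W n)" for n
    using funpow_cyclic_on_neq[OF \<open>cyclic_on \<sigma> A\<close> inA(2) i(2,3)]
    by (simp add: \<open>\<delta> = \<sigma> ^^ j\<close> i(1) funpow_swap1)
  from no_twisted_cube[of ?W, OF shift_word_double comm no_fix this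
      permutes_inj[OF \<open>\<sigma> permutes A\<close>] m, of p] rep
  show False by blast
qed

end
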